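(* Let $n\ge3$ be an odd integer and let $$\varphi(z)=\int_0^z(1-\zeta^n)^{-2/n}\,d\zeta,\qquad z\in\mathbb{D},$$ which maps the unit disk $\mathbb{D}$ conformally onto a regular $n$-gon. Define, for $z\in\mathbb{D}$, $$h(z)=\sum_{k=0}^{n-1}\frac{z^{2k+1}}{2k+1}\,F_1\left(\frac{2k+1}{n},\,1+\frac2n,\,1;\,1+\frac{2k+1}{n};\,z^n,-z^n\right),$$ $$g(z)=\sum_{k=1}^{n}\frac{z^{2k+1}}{2k+1}\,F_1\left(\frac{2k+1}{n},\,1+\frac2n,\,1;\,1+\frac{2k+1}{n};\,z^n,-z^n\right).$$ Then $f=h+\overline{g}$ is the harmonic shear of $\varphi$ with dilatation $\omega(z)=z^2$, and $f$ maps $\mathbb{D}$ univalently onto a domain which is convex in the horizontal direction.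
   Context: $\mathbb{D}=\{z\in\mathbb{C}:|z|<1\}$; the power $(1-\zeta^n)^{-2/n}$ is the principal branch. $F_1$ is the first Appell hypergeometric function $$F_1(a,b_1,b_2;c;x,y)=\sum_{k=0}^\infty\sum_{l=0}^\infty\frac{(a)_{k+l}(b_1)_k(b_2)_l}{(c)_{k+l}\,k!\,l!}x^ky^l,\qquad |x|,|y|<1,$$ where $(\alpha)_0=1$ and $(\alpha)_j=\alpha(\alpha+1)\cdots(\alpha+j-1)$ is the Pochhammer symbol. Univalent means injective. A domain $\Omega\subset\mathbb{C}$ is convex in the horizontal direction (CHD) if its intersection with each horizontal line is connected (or empty). For a conformal mapping $\varphi$ of $\mathbb{D}$ onto a CHD domain with $\varphi(0)=0$, and an analytic $\omega$ with $|\omega|<1$ in $\mathbb{D}$, the harmonic shear of $\varphi$ with dilatation $\omega$ is the harmonic function $f=h+\overline{g}$, where $h,g$ are analytic in $\mathbb{D}$, $h(0)=g(0)=0$, $h-g=\varphi$ and $g'=\omega h'$. *)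

theory Defs
  imports "HOL-Complex_Analysis.Complex_Analysis"
begin

definition appell_F1 ::
  "complex \<Rightarrow> complex \<Rightarrow> complex \<Rightarrow> complex \<Rightarrow> complex \<Rightarrow> complex \<Rightarrow> complex" where
  "appell_F1 a b1 b2 c x y =
     (\<Sum>k. \<Sum>l. pochhammer a (k + l) * pochhammer b1 k * pochhammer b2 l
                / (pochhammer c (k + l) * fact k * fact l) * x ^ k * y ^ l)"

definition is_domain :: "complex set \<Rightarrow> bool" where
  "is_domain S \<longleftrightarrow> open S \<and> connected S \<and> S \<noteq> {}"

definition CHD :: "complex set \<Rightarrow> bool" where
  "CHD S \<longleftrightarrow> is_domain S \<and> (\<forall>y. connected (S \<inter> {z. Im z = y}))"

definition maps_conformally_onto :: "(complex \<Rightarrow> complex) \<Rightarrow> complex set \<Rightarrow> complex set \<Rightarrow> bool" where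
  "maps_conformally_onto \<phi> S T \<longleftrightarrow> \<phi> holomorphic_on S \<and> inj_on \<phi> S \<and> \<phi> ` S = T"

(* The polygon is the open region bounded by its edges; c is its centre and c + v one of its
   vertices. *)
definition is_regular_polygon :: "nat \<Rightarrow> complex set \<Rightarrow> bool" where
  "is_regular_polygon n P \<longleftrightarrow>
     3 \<le> n \<and> (\<exists>c v. v \<noteq> 0 \<and>
       P = interior (convex hull {c + v * cis (2 * pi * real k / real n) | k. k < n}))"

(* The decomposition f = h + cnj g is part of the relation; the functions matter only on the
   unit disk. *)
definition is_harmonic_shear ::
  "(complex \<Rightarrow> complex) \<Rightarrow> (complex \<Rightarrow> complex) \<Rightarrow>
   (complex \<Rightarrow> complex) \<Rightarrow> (complex \<Rightarrow> complex) \<Rightarrow> (complex \<Rightarrow> complex) \<Rightarrow> bool" where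
  "is_harmonic_shear \<phi> \<omega> h g f \<longleftrightarrow>
     (\<exists>\<Omega>. CHD \<Omega> \<and> maps_conformally_onto \<phi> (ball 0 1) \<Omega>) \<and> \<phi> 0 = 0 \<and>
     \<omega> holomorphic_on ball 0 1 \<and> (\<forall>z\<in>ball 0 1. norm (\<omega> z) < 1) \<and>
     h holomorphic_on ball 0 1 \<and> g holomorphic_on ball 0 1 \<and> h 0 = 0 \<and> g 0 = 0 \<and>
     (\<forall>z\<in>ball 0 1. h z - g z = \<phi> z) \<and>
     (\<forall>z\<in>ball 0 1. deriv g z = \<omega> z * deriv h z) \<and>
     (\<forall>z\<in>ball 0 1. f z = h z + cnj (g z))"

end

theory Submission
  imports Defs
begin

text \<open>Termwise integration of \<open>\<zeta>^(2k) (1 - \<zeta>^n) powr (- 1 - 2/n) / (1 + \<zeta>^n)\<close> yields the Appell terms,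
  and summing the geometric progression in \<open>\<zeta>^2\<close> gives \<open>h' = \<phi>' / (1 - z^2)\<close> and \<open>g' = z^2 h'\<close>.
  The map \<open>\<phi>\<close> is injective because \<open>Re \<phi>' > 0\<close> on the convex disk. Its Taylor series converges
  absolutely up to the circle, and \<open>\<phi> (cis \<theta>)\<close> moves in a constant direction between consecutive
  \<open>n\<close>-th roots of unity, so the circle lands on the edges of the polygon; the maximum principle and
  connectedness then identify the image with its interior.
  Finally, in the coordinate \<open>w = \<phi> z\<close> the shear is \<open>w + 2 Re (g (\<phi>\<inverse> w))\<close>, which maps each
  horizontal segment strictly increasingly into its own horizontal line.\<close>

section \<open>Power series and the Appell function\<close>

lemma binomial_series_pochhammer:
  fixes a z :: complex
  assumes "norm z < 1"
  shows "(\<lambda>k. pochhammer a k / fact k * z ^ k) sums (1 - z) powr (- a)"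
proof -
  have "(\<lambda>k. (-a gchoose k) * (-z) ^ k) sums (1 + (-z)) powr (-a)"
    using assms by (intro gen_binomial_complex) auto
  moreover have "(-a gchoose k) * (-z) ^ k = pochhammer a k / fact k * z ^ k" for k
    by (subst power_minus) (simp add: gbinomial_pochhammer)
  ultimately show ?thesis by simp
qed

text \<open>Convergence at a real \<open>r\<close> with \<open>norm w < r < 1\<close> forces
  absolute convergence at \<open>w\<close>.\<close>

lemma powser_disc_norm_summable:
  fixes c :: "nat \<Rightarrow> complex"
  assumes c: "\<And>w. norm w < 1 \<Longrightarrow> summable (\<lambda>m. c m * w ^ m)" and w: "norm w < 1"
  shows "summable (\<lambda>m. norm (c m * w ^ m))"
proof -
  obtain r where r: "norm w < r" "r < 1" using w dense by blast
  then have "0 < r" by (meson norm_ge_zero order_le_less_trans)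
  then show ?thesis
    using r c[of "of_real r"] by (intro powser_insidea[of c "of_real r"]) auto
qed

lemma summable_arith_progression_series:
  fixes c :: "nat \<Rightarrow> complex"
  assumes c: "\<And>w. norm w < 1 \<Longrightarrow> summable (\<lambda>m. c m * w ^ m)"
    and "p > 0" and w: "norm w < 1"
  shows "summable (\<lambda>m. c m / of_nat (p + n * m) * w ^ m)"
proof (rule summable_comparison_test'[where N = 0])
  show "summable (\<lambda>m. norm (c m * w ^ m))"
    by (intro powser_disc_norm_summable c w)
  fix m
  have "real (p + n * m) \<ge> 1" using \<open>p > 0\<close> by linarith
  then have "norm (c m) / real (p + n * m) \<le> norm (c m)"
    by (simp add: divide_le_eq mult_le_cancel_left1)
  then show "norm (c m / of_nat (p + n * m) * w ^ m) \<le> norm (c m * w ^ m)"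
    unfolding norm_mult norm_divide norm_of_nat by (intro mult_right_mono) auto
qed

text \<open>This is termwise integration of \<open>z ^ (p - 1)\<close> times a power series in
  \<open>z ^ n\<close>. With \<open>w = z ^ n\<close>, the product and chain rules give
  \<open>z ^ (p - 1)\<close> times \<open>p * Q w + n * w * Q' w\<close>, whose coefficient of
  \<open>w ^ m\<close> is \<open>(p + n * m) * q m = c m\<close>.\<close>

lemma has_field_derivative_arith_progression_series:
  fixes c :: "nat \<Rightarrow> complex"
  assumes c: "\<And>w. norm w < 1 \<Longrightarrow> summable (\<lambda>m. c m * w ^ m)"
    and "p > 0" "n > 0" and z: "norm z < 1"
  shows "((\<lambda>z. z ^ p * (\<Sum>m. c m / of_nat (p + n * m) * (z ^ n) ^ m))
           has_field_derivative z ^ (p - 1) * (\<Sum>m. c m * (z ^ n) ^ m)) (at z)"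
proof -
  define q where "q m = c m / of_nat (p + n * m)" for m
  define Q where "Q w = (\<Sum>m. q m * w ^ m)" for w
  have sq: "summable (\<lambda>m. q m * w ^ m)" if w: "norm w < 1" for w
    unfolding q_def by (intro summable_arith_progression_series c w \<open>p > 0\<close>)
  define w where "w = z ^ n"
  have w: "norm w < 1"
    using z \<open>n > 0\<close> by (simp add: w_def norm_power power_less_one_iff)
  \<comment> \<open>Differentiating the series at \<open>w\<close> uses convergence at a point of
    larger modulus.\<close>
  obtain r where r: "norm w < r" "r < 1" using w dense by blast
  then have "0 < r" by (meson norm_ge_zero order_le_less_trans)
  have Q: "(Q has_field_derivative (\<Sum>m. diffs q m * w ^ m)) (at w)"
    unfolding Q_def by (rule termdiffs_strong[of _ "of_real r"]) (use r \<open>0 < r\<close> sq[of "of_real r"] in auto)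
  have "summable (\<lambda>m. diffs q m * w ^ m)"
    by (rule termdiff_converges[of _ 1]) (use w sq in auto)
  then have "(\<lambda>m. of_nat m * q m * w ^ (m - Suc 0)) sums (\<Sum>m. diffs q m * w ^ m)"
    by (rule diffs_equiv)
  then have "(\<lambda>m. of_nat p * (q m * w ^ m) + of_nat n * w * (of_nat m * q m * w ^ (m - Suc 0)))
      sums (of_nat p * Q w + of_nat n * w * (\<Sum>m. diffs q m * w ^ m))"
    unfolding Q_def using sq[OF w] by (intro sums_add sums_mult summable_sums)
  moreover have "of_nat p * (q m * w ^ m) + of_nat n * w * (of_nat m * q m * w ^ (m - Suc 0))
      = c m * w ^ m" for m
  proof -
    have ne: "(of_nat (p + n * m) :: complex) \<noteq> 0"
      using \<open>p > 0\<close> by (simp only: of_nat_eq_0_iff)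
    have "of_nat p * (q m * w ^ m) + of_nat n * w * (of_nat m * q m * w ^ (m - Suc 0))
        = (of_nat (p + n * m) * q m) * w ^ m"
      by (cases m) (auto simp: algebra_simps)
    also have "of_nat (p + n * m) * q m = c m"
      unfolding q_def using ne by simp
    finally show ?thesis .
  qed
  ultimately have S: "(\<Sum>m. c m * w ^ m) = of_nat p * Q w + of_nat n * w * (\<Sum>m. diffs q m * w ^ m)"
    by (simp add: sums_iff)
  have pow: "((\<lambda>z. z ^ k) has_field_derivative of_nat k * z ^ (k - 1)) (at z)" for k
    by (auto intro!: derivative_eq_intros)
  have "((\<lambda>z. z ^ p * Q (z ^ n)) has_field_derivative
      z ^ p * ((\<Sum>m. diffs q m * w ^ m) * (of_nat n * z ^ (n - 1)))
      + (of_nat p * z ^ (p - 1)) * Q w) (at z)"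
    using DERIV_mult'[OF pow[of p] DERIV_chain2[of Q _ "\<lambda>z. z ^ n", OF Q[unfolded w_def] pow[of n]]]
    by (simp only: w_def)
  also have "z ^ p * ((\<Sum>m. diffs q m * w ^ m) * (of_nat n * z ^ (n - 1)))
      + (of_nat p * z ^ (p - 1)) * Q w = z ^ (p - 1) * (\<Sum>m. c m * w ^ m)"
  proof -
    have "z ^ p = z * z ^ (p - 1)" "w = z * z ^ (n - 1)"
      using \<open>p > 0\<close> \<open>n > 0\<close> by (simp_all add: w_def power_eq_if)
    then have "z ^ p * (d * (of_nat n * z ^ (n - 1))) + of_nat p * z ^ (p - 1) * c
        = z ^ (p - 1) * (of_nat p * c + of_nat n * w * d)" for c d
      by (simp only: ring_distribs mult_ac add.commute)
    then show ?thesis unfolding S .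
  qed
  finally show ?thesis by (simp only: Q_def q_def w_def)
qed

section \<open>Collapsing the Appell double series to a power series\<close>

text \<open>Splitting off the first or the last factor of \<open>pochhammer a (Suc m)\<close> gives
  the two sides of a product identity. For \<open>a = p / n\<close> the ratio becomes
  \<open>p / (p + n * m)\<close>, the divisor produced by integration.\<close>

lemma pochhammer_shift_ratio:
  fixes a :: complex
  assumes "\<And>m. a + of_nat m \<noteq> 0"
  shows "pochhammer a m / pochhammer (1 + a) m = a / (a + of_nat m)"
proof -
  have "a * pochhammer (1 + a) m = pochhammer a m * (a + of_nat m)"
    using pochhammer_rec[of a m] by (simp add: pochhammer_Suc add.commute)
  moreover have "pochhammer (1 + a) m \<noteq> 0"
    using assms[of "Suc _"] by (auto simp: pochhammer_eq_0_iff eq_neg_iff_add_eq_0 algebra_simps)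
  ultimately show ?thesis using assms by (simp add: field_simps)
qed

text \<open>The family is dominated by \<open>norm (u k) * norm (v l)\<close>, hence summable over
  all pairs, so rows and diagonals \<open>k + l = m\<close> give the same total. The weight is
  constant on each diagonal and can be pulled out there.\<close>

lemma suminf_suminf_Cauchy_product:
  fixes u v e :: "nat \<Rightarrow> complex"
  assumes u: "summable (\<lambda>k. norm (u k))" and v: "summable (\<lambda>l. norm (v l))"
    and e: "\<And>m. norm (e m) \<le> 1"
  shows "(\<Sum>k. \<Sum>l. e (k + l) * (u k * v l)) = (\<Sum>m. e m * (\<Sum>i\<le>m. u i * v (m - i)))"
proof -
  define f where "f = (\<lambda>(k, l). e (k + l) * (u k * v l))"
  have sums: "((\<lambda>k. norm (u k)) has_sum (\<Sum>k. norm (u k))) UNIV"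
      "((\<lambda>l. norm (v l)) has_sum (\<Sum>l. norm (v l))) UNIV"
    using u v by (auto intro!: norm_summable_imp_has_sum summable_sums)
  have bound: "norm (f (k, l)) \<le> norm (u k) * norm (v l)" for k l
    using mult_right_mono[OF e[of "k + l"], of "norm (u k * v l)"]
    by (simp add: f_def norm_mult)
  have "(\<lambda>(k, l). norm (u k) * norm (v l)) summable_on UNIV \<times> UNIV"
    using has_sum_imp_summable[OF has_sum_cmult_left[OF sums(1), of "\<Sum>l. norm (v l)"]]
    by (intro summable_on_SigmaI[where g = "\<lambda>k. norm (u k) * (\<Sum>l. norm (v l))"])
      (auto intro!: has_sum_cmult_right sums)
  then have "(\<lambda>x. norm (f x)) summable_on UNIV \<times> UNIV"
    by (rule summable_on_comparison_test) (use bound in auto)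
  then have "f summable_on UNIV \<times> UNIV"
    by (rule abs_summable_summable)
  then obtain T where T: "(f has_sum T) (UNIV \<times> UNIV)"
    by (auto simp: summable_on_def)
  have "((\<lambda>l. f (k, l)) has_sum (\<Sum>l. f (k, l))) UNIV" for k
  proof -
    have "norm (norm (f (k, l))) \<le> norm (u k) * norm (v l)" for l
      using bound[of k l] by simp
    then have "summable (\<lambda>l. norm (f (k, l)))"
      by (intro summable_comparison_test'[OF summable_mult[OF v], where N = 0])
    from norm_summable_imp_has_sum[OF this summable_sums[OF summable_norm_cancel[OF this]]]
    show ?thesis .
  qed
  then have "((\<lambda>k. \<Sum>l. f (k, l)) has_sum T) UNIV"
    by (intro has_sum_SigmaD[OF T])
  then have "(\<Sum>k. \<Sum>l. f (k, l)) = T"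
    by (intro sums_unique[symmetric] has_sum_imp_sums)
  \<comment> \<open>The pair \<open>(k, l)\<close> is renamed \<open>(m, i)\<close> with
    \<open>m = k + l\<close> and \<open>i = k\<close>, so \<open>i\<close> runs up to
    \<open>m\<close>.\<close>
  moreover have "((\<lambda>(m, i). e m * (u i * v (m - i))) has_sum T) (SIGMA m:UNIV. {..m})"
    by (rule has_sum_reindex_bij_witness[of "UNIV \<times> UNIV" "\<lambda>(m, i). (i, m - i)" "\<lambda>(k, l). (k + l, k)",
          THEN iffD1, OF _ _ _ _ _ refl T]) (auto simp: f_def)
  then have "((\<lambda>m. \<Sum>i\<le>m. e m * (u i * v (m - i))) has_sum T) UNIV"
    by (rule has_sum_SigmaD) auto
  then have "(\<Sum>m. \<Sum>i\<le>m. e m * (u i * v (m - i))) = T"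
    by (intro sums_unique[symmetric] has_sum_imp_sums)
  ultimately show ?thesis
    by (simp add: f_def sum_distrib_left)
qed

lemma power_mult_minus_power:
  fixes w :: complex
  assumes "i \<le> m"
  shows "w ^ i * (- w) ^ (m - i) = (- 1) ^ (m - i) * w ^ m"
proof -
  have "w ^ i * (- w) ^ (m - i) = (- 1) ^ (m - i) * (w ^ i * w ^ (m - i))"
    by (subst power_minus) (simp only: mult_ac)
  also have "w ^ i * w ^ (m - i) = w ^ m"
    using assms by (simp only: power_add[symmetric] le_add_diff_inverse)
  finally show ?thesis .
qed

text \<open>Taylor coefficients of \<open>(1 - w) powr (- b) / (1 + w)\<close>: the Cauchy product
  of the binomial series with the geometric series in \<open>- w\<close>.\<close>

definition shear_coeff :: "complex \<Rightarrow> nat \<Rightarrow> complex" where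
  "shear_coeff b m = (\<Sum>i\<le>m. pochhammer b i / fact i * (- 1) ^ (m - i))"

lemma shear_coeff_sums:
  assumes w: "norm w < 1"
  shows "(\<lambda>m. shear_coeff b m * w ^ m) sums ((1 - w) powr (- b) / (1 + w))"
proof -
  define u v where "u k = pochhammer b k / fact k * w ^ k" and "v l = (- w) ^ l" for k l :: nat
  have u: "summable (\<lambda>k. norm (u k))"
    unfolding u_def using binomial_series_pochhammer w
    by (intro powser_disc_norm_summable) (auto simp: sums_iff)
  have v: "summable (\<lambda>l. norm (v l))"
    using w by (simp add: v_def norm_power)
  have "(\<Sum>l. v l) = 1 / (1 + w)"
    using suminf_geometric[of "- w"] w by (simp add: v_def)
  moreover have "(\<Sum>k. u k) = (1 - w) powr (- b)"
    unfolding u_def using binomial_series_pochhammer[OF w] by (simp add: sums_iff)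
  moreover have "(\<lambda>m. \<Sum>i\<le>m. u i * v (m - i)) sums ((\<Sum>k. u k) * (\<Sum>l. v l))"
    by (rule Cauchy_product_sums[OF u v])
  moreover have "(\<Sum>i\<le>m. u i * v (m - i)) = shear_coeff b m * w ^ m" for m
    unfolding shear_coeff_def sum_distrib_right
    by (intro sum.cong refl) (simp add: u_def v_def power_mult_minus_power mult.assoc)
  ultimately show ?thesis by simp
qed

text \<open>With \<open>a = p / n\<close> and \<open>c = 1 + a\<close>, the quotient of the two
  Pochhammer symbols of index \<open>k + l\<close> depends on \<open>k + l\<close> alone and is
  \<open>p / (p + n * (k + l))\<close>. Summation along diagonals then leaves
  \<open>shear_coeff\<close>.\<close>

lemma appell_F1_arith_progression:
  assumes "p > 0" "n > 0" and w: "norm w < 1"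
  shows "appell_F1 (of_nat p / of_nat n) b 1 (1 + of_nat p / of_nat n) w (- w) / of_nat p =
    (\<Sum>m. shear_coeff b m / of_nat (p + n * m) * w ^ m)"
proof -
  define a :: complex where "a = of_nat p / of_nat n"
  define e :: "nat \<Rightarrow> complex" where "e m = of_nat p / of_nat (p + n * m)" for m
  define u v where "u k = pochhammer b k / fact k * w ^ k" and "v l = (- w) ^ l" for k l :: nat
  have u: "summable (\<lambda>k. norm (u k))"
    unfolding u_def using binomial_series_pochhammer w
    by (intro powser_disc_norm_summable) (auto simp: sums_iff)
  have v: "summable (\<lambda>l. norm (v l))"
    using w by (simp add: v_def norm_power)
  have e1: "norm (e m) \<le> 1" for m
    unfolding e_def norm_divide norm_of_nat using \<open>p > 0\<close>
    by (simp add: divide_le_eq)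
  have ratio: "pochhammer a m / pochhammer (1 + a) m = e m" for m
  proof -
    have eq: "a + of_nat m = of_nat (p + n * m) / of_nat n" for m
      using \<open>n > 0\<close> by (simp add: a_def field_simps)
    have ne: "(of_nat (p + n * m) :: complex) \<noteq> 0" for m
      using \<open>p > 0\<close> by (simp only: of_nat_eq_0_iff)
    have "pochhammer a m / pochhammer (1 + a) m = a / (a + of_nat m)"
      by (rule pochhammer_shift_ratio) (use ne \<open>n > 0\<close> in \<open>simp add: eq del: of_nat_add of_nat_mult\<close>)
    also have "\<dots> = e m"
      unfolding eq using \<open>n > 0\<close> by (simp add: e_def a_def del: of_nat_add of_nat_mult)
    finally show ?thesis .
  qed
  have "pochhammer a (k + l) * pochhammer b k * pochhammer 1 l
      / (pochhammer (1 + a) (k + l) * fact k * fact l) * w ^ k * (- w) ^ l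
      = e (k + l) * (u k * v l)" for k l
  proof -
    \<comment> \<open>Here \<open>t\<close> is \<open>fact l = pochhammer 1 l\<close>: the third
      parameter 1 turns the inner series into a geometric one.\<close>
    have cancel: "x * y * t / (c * d * t) * r * s = x / c * (y / d * r * s)" if "t \<noteq> 0"
      for x y t c d r s :: complex
      using that by simp
    show ?thesis
      unfolding ratio[symmetric] u_def v_def pochhammer_fact[symmetric]
      by (rule cancel[OF fact_nonzero])
  qed
  then have "appell_F1 a b 1 (1 + a) w (- w) = (\<Sum>k. \<Sum>l. e (k + l) * (u k * v l))"
    unfolding appell_F1_def by (simp only:)
  also have "\<dots> = (\<Sum>m. e m * (\<Sum>i\<le>m. u i * v (m - i)))"
    by (rule suminf_suminf_Cauchy_product[OF u v e1])
  also have "\<dots> = (\<Sum>m. of_nat p * (shear_coeff b m / of_nat (p + n * m) * w ^ m))"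
  proof (rule suminf_cong)
    fix m
    have "(\<Sum>i\<le>m. u i * v (m - i)) = shear_coeff b m * w ^ m"
      unfolding shear_coeff_def sum_distrib_right
      by (intro sum.cong refl) (simp add: u_def v_def power_mult_minus_power mult.assoc)
    then show "e m * (\<Sum>i\<le>m. u i * v (m - i)) =
        of_nat p * (shear_coeff b m / of_nat (p + n * m) * w ^ m)"
      by (simp only: e_def times_divide_eq_left times_divide_eq_right mult.assoc)
  qed
  also have "\<dots> = of_nat p * (\<Sum>m. shear_coeff b m / of_nat (p + n * m) * w ^ m)"
    by (intro suminf_mult summable_arith_progression_series sums_summable[OF shear_coeff_sums]
        \<open>p > 0\<close> w)
  finally have "appell_F1 a b 1 (1 + a) w (- w) =
      of_nat p * (\<Sum>m. shear_coeff b m / of_nat (p + n * m) * w ^ m)" .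
  moreover have "(of_nat p :: complex) \<noteq> 0"
    using \<open>p > 0\<close> by (simp only: of_nat_eq_0_iff)
  ultimately show ?thesis
    unfolding a_def by (simp only: nonzero_mult_div_cancel_left not_False_eq_True)
qed

section \<open>Univalence of harmonic shears\<close>

text \<open>One direction of the shear theorem of Clunie and Sheil-Small: a shear moves points of
  \<open>\<Omega>\<close> only horizontally and keeps their order on each horizontal line.\<close>

lemma harmonic_shear_univalent:
  assumes "is_harmonic_shear \<phi> \<omega> h g f"
  shows "inj_on f (ball 0 1)" and "CHD (f ` ball 0 1)"
proof -
  let ?D = "ball 0 1 :: complex set"
  obtain \<Omega> where \<Omega>: "CHD \<Omega>" "\<phi> holomorphic_on ?D" "inj_on \<phi> ?D" "\<phi> ` ?D = \<Omega>"
    and \<omega>: "\<And>z. z \<in> ?D \<Longrightarrow> norm (\<omega> z) < 1"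
    and hol: "h holomorphic_on ?D" "g holomorphic_on ?D"
    and hg: "\<And>z. z \<in> ?D \<Longrightarrow> h z - g z = \<phi> z"
    and dg: "\<And>z. z \<in> ?D \<Longrightarrow> deriv g z = \<omega> z * deriv h z"
    and f: "\<And>z. z \<in> ?D \<Longrightarrow> f z = h z + cnj (g z)"
    using assms unfolding is_harmonic_shear_def maps_conformally_onto_def by blast
  have "open \<Omega>"
    using \<Omega>(1) by (auto simp: CHD_def is_domain_def)
  obtain \<psi> where \<psi>: "\<psi> holomorphic_on \<phi> ` ?D"
      "\<And>z. z \<in> ?D \<Longrightarrow> deriv \<phi> z * deriv \<psi> (\<phi> z) = 1"
      "\<And>z. z \<in> ?D \<Longrightarrow> \<psi> (\<phi> z) = z"
    using holomorphic_has_inverse[OF \<Omega>(2) open_ball \<Omega>(3)] by metis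
  \<comment> \<open>\<open>f \<circ> \<phi>\<inverse>\<close> preserves imaginary parts and its real part is that of the holomorphic \<open>F\<close>,
    whose derivative \<open>(1 + \<omega>) / (1 - \<omega>)\<close> lies in the right half-plane.\<close>
  define F where "F w = w + 2 * g (\<psi> w)" for w
  \<comment> \<open>Since \<open>h = \<phi> + g\<close>, the value \<open>f z\<close> is
    \<open>\<phi> z\<close> plus twice the real part of \<open>g z\<close>.\<close>
  have f_Re: "f z = of_real (Re (F (\<phi> z))) + \<i> * of_real (Im (\<phi> z))" if "z \<in> ?D" for z
    using hg[OF that, symmetric]
    unfolding F_def \<psi>(3)[OF that] f[OF that] by (simp add: complex_eq_iff)
  have dF: "\<exists>D. (F has_field_derivative D) (at w) \<and> Re D > 0" if wO: "w \<in> \<Omega>" for w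
  proof -
    obtain z where z: "z \<in> ?D" "w = \<phi> z" using wO \<Omega>(4) by blast
    have "(h has_field_derivative deriv h z) (at z)" "(g has_field_derivative deriv g z) (at z)"
      using hol z by (auto intro: holomorphic_derivI)
    then have "((\<lambda>z. h z - g z) has_field_derivative deriv h z - deriv g z) (at z)"
      by (rule DERIV_diff)
    then have "(\<phi> has_field_derivative deriv h z - deriv g z) (at z)"
      by (rule has_field_derivative_transform_within_open[OF _ open_ball z(1)]) (use hg in auto)
    then have "deriv \<phi> z = (1 - \<omega> z) * deriv h z"
      using dg[OF z(1)] by (simp add: DERIV_imp_deriv algebra_simps)
    \<comment> \<open>This is the inverse function relation for \<open>\<phi>\<close> and
      \<open>\<psi>\<close>, with the derivative of \<open>\<phi>\<close> written as
      \<open>(1 - \<omega> z) * deriv h z\<close>.\<close>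
    then have 1: "(1 - \<omega> z) * (deriv h z * deriv \<psi> w) = 1"
      using \<psi>(2)[OF z(1)] z(2) by (simp add: mult_ac)
    then have ne: "1 - \<omega> z \<noteq> 0" by auto
    have "(\<psi> has_field_derivative deriv \<psi> w) (at w)"
      using \<psi>(1) \<open>open \<Omega>\<close> wO \<Omega>(4) by (auto intro: holomorphic_derivI)
    moreover have "(g has_field_derivative deriv g z) (at (\<psi> w))"
      using hol z \<psi>(3)[OF z(1)] by (auto intro: holomorphic_derivI)
    ultimately have "(F has_field_derivative 1 + 2 * (deriv g z * deriv \<psi> w)) (at w)"
      unfolding F_def by (intro DERIV_add DERIV_ident DERIV_cmult DERIV_chain2[of g])
    also have "1 + 2 * (deriv g z * deriv \<psi> w) = (1 + \<omega> z) / (1 - \<omega> z)"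
    proof -
      have "deriv h z * deriv \<psi> w = 1 / (1 - \<omega> z)"
        using 1 ne by (simp add: eq_divide_eq mult.commute)
      then have "deriv g z * deriv \<psi> w = \<omega> z / (1 - \<omega> z)"
        using dg[OF z(1)] by (simp add: mult.assoc)
      moreover have "1 + 2 * (\<omega> z / (1 - \<omega> z)) = (1 + \<omega> z) / (1 - \<omega> z)"
        using ne by (simp add: field_simps)
      ultimately show ?thesis by simp
    qed
    finally have "(F has_field_derivative (1 + \<omega> z) / (1 - \<omega> z)) (at w)" .
    moreover have "Re ((1 + \<omega> z) / (1 - \<omega> z)) > 0"
    proof -
      have "Re ((1 + \<omega> z) / (1 - \<omega> z)) = (1 - (norm (\<omega> z))\<^sup>2) / (norm (1 - \<omega> z))\<^sup>2"
        unfolding Re_divide cmod_power2 by (simp add: power2_eq_square algebra_simps)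
      moreover have "(norm (\<omega> z))\<^sup>2 < 1"
        using \<omega>[OF z(1)] by (simp add: abs_square_less_1)
      ultimately show ?thesis using ne by simp
    qed
    ultimately show ?thesis by blast
  qed
  \<comment> \<open>The slice of \<open>\<Omega>\<close> at a fixed height is connected, so its
    projection to the real axis is an interval.\<close>
  have seg: "closed_segment w w' \<subseteq> \<Omega>" if "w \<in> \<Omega>" "w' \<in> \<Omega>" "Im w = Im w'" for w w'
  proof
    fix u assume u: "u \<in> closed_segment w w'"
    let ?L = "\<Omega> \<inter> {z. Im z = Im w}"
    have "connected (Re ` ?L)"
      using \<Omega>(1) by (intro connected_continuous_image continuous_intros) (auto simp: CHD_def)
    then have "convex (Re ` ?L)" using connected_convex_1 by blast
    moreover have "Re u \<in> closed_segment (Re w) (Re w')"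
      using u by (auto simp: in_segment)
    ultimately have "Re u \<in> Re ` ?L"
      using that closed_segment_subset[of "Re w" "Re ` ?L" "Re w'"] by auto
    then obtain t where t: "t \<in> \<Omega>" "Im t = Im w" "Re t = Re u" by auto
    moreover have "Im u = Im w" using u that(3) by (auto simp: in_segment left_diff_distrib)
    ultimately have "t = u" by (simp add: complex_eq_iff)
    then show "u \<in> \<Omega>" using t by simp
  qed
  \<comment> \<open>The mean value theorem for the real part of \<open>F\<close> applies on the
    segment; \<open>w' - w\<close> is real, so the increment has the sign of
    \<open>Re (deriv F u)\<close>.\<close>
  have less: "Re (F w) < Re (F w')" if ww: "w \<in> \<Omega>" "w' \<in> \<Omega>" "Im w = Im w'" "Re w < Re w'" for w w'
  proof -
    have "\<exists>u. u \<in> closed_segment w w' \<and> Re (F w') - Re (F w) = Re (deriv F u * (w' - w))"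
    proof (rule complex_mvt_line)
      fix u assume "u \<in> closed_segment w w'"
      then show "(F has_field_derivative deriv F u) (at u)"
        using dF seg[OF ww(1-3)] DERIV_imp_deriv by (metis subsetD)
    qed
    then obtain u where u: "u \<in> closed_segment w w'"
      "Re (F w') - Re (F w) = Re (deriv F u * (w' - w))" by blast
    have "Re (deriv F u) > 0"
      using dF[of u] seg[OF ww(1-3)] u(1) DERIV_imp_deriv by (metis subsetD)
    moreover have "Re (F w') - Re (F w) = Re (deriv F u) * (Re w' - Re w)"
      using u(2) ww(3) by simp
    ultimately show ?thesis using ww(4) by (smt (verit) mult_pos_pos)
  qed
  show inj: "inj_on f ?D"
  proof (rule inj_onI)
    fix z z' assume z: "z \<in> ?D" "z' \<in> ?D" "f z = f z'"
    then have "Re (F (\<phi> z)) = Re (F (\<phi> z'))" "Im (\<phi> z) = Im (\<phi> z')"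
      using f_Re by (auto simp: complex_eq_iff)
    moreover have "\<phi> z \<in> \<Omega>" "\<phi> z' \<in> \<Omega>" using z \<Omega>(4) by auto
    ultimately have "\<phi> z = \<phi> z'"
      using less[of "\<phi> z" "\<phi> z'"] less[of "\<phi> z'" "\<phi> z"]
      by (metis complex_eqI less_irrefl linorder_neqE)
    then show "z = z'" using z \<Omega>(3) by (auto dest: inj_onD)
  qed
  have cont: "continuous_on ?D f"
  proof (subst continuous_on_cong[OF refl f])
    show "continuous_on ?D (\<lambda>z. h z + cnj (g z))"
      by (intro continuous_intros holomorphic_on_imp_continuous_on hol)
  qed
  show "CHD (f ` ?D)"
    unfolding CHD_def is_domain_def
  proof (intro conjI allI)
    \<comment> \<open>\<open>f\<close> is continuous and injective but only harmonic, so openness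
      comes from invariance of domain.\<close>
    show "open (f ` ?D)"
      by (rule invariance_of_domain[OF cont open_ball inj])
    show "connected (f ` ?D)"
      by (rule connected_continuous_image[OF cont]) simp
    show "f ` ?D \<noteq> {}" by simp
    fix y
    \<comment> \<open>Because \<open>f\<close> keeps the imaginary part of \<open>\<phi> z\<close>,
      each slice of the image is the continuous image of the slice of \<open>\<Omega>\<close> at the
      same height.\<close>
    have "f ` ?D \<inter> {z. Im z = y} = (\<lambda>w. f (\<psi> w)) ` (\<Omega> \<inter> {z. Im z = y})"
    proof (intro set_eqI iffI)
      fix x assume "x \<in> f ` ?D \<inter> {z. Im z = y}"
      then obtain z where z: "z \<in> ?D" "x = f z" "Im x = y" by blast
      then have "\<phi> z \<in> \<Omega> \<inter> {z. Im z = y}" "x = f (\<psi> (\<phi> z))"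
        using \<Omega>(4) f_Re[OF z(1)] \<psi>(3) by auto
      then show "x \<in> (\<lambda>w. f (\<psi> w)) ` (\<Omega> \<inter> {z. Im z = y})" by (rule rev_image_eqI)
    next
      fix x assume "x \<in> (\<lambda>w. f (\<psi> w)) ` (\<Omega> \<inter> {z. Im z = y})"
      then obtain z where z: "z \<in> ?D" "Im (\<phi> z) = y" "x = f (\<psi> (\<phi> z))"
        using \<Omega>(4) by blast
      then have "x = f z" "Im x = y"
        using f_Re[OF z(1)] \<psi>(3) by auto
      then show "x \<in> f ` ?D \<inter> {z. Im z = y}"
        using z(1) by blast
    qed
    moreover have "continuous_on (\<Omega> \<inter> {z. Im z = y}) (\<lambda>w. f (\<psi> w))"
    proof (rule continuous_on_compose2[OF cont])
      show "continuous_on (\<Omega> \<inter> {z. Im z = y}) \<psi>"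
        using \<psi>(1) \<Omega>(4) by (metis holomorphic_on_imp_continuous_on continuous_on_subset inf_le1)
      show "\<psi> ` (\<Omega> \<inter> {z. Im z = y}) \<subseteq> ?D"
        using \<Omega>(4) \<psi>(3) by auto
    qed
    ultimately show "connected (f ` ?D \<inter> {z. Im z = y})"
      using \<Omega>(1) connected_continuous_image by (metis CHD_def)
  qed
qed

section \<open>The conformal map onto a regular polygon\<close>

text \<open>The maximum principle puts the image of the disk in \<open>K\<close>, and openness puts
  it in the interior. The image of the closed disk adds only boundary values, which avoid the
  interior, so the image is clopen in the connected set \<open>interior K\<close>.\<close>

lemma conformal_image_eq_interior:
  fixes f :: "complex \<Rightarrow> complex"
  assumes cont: "continuous_on (cball 0 1) f" and hol: "f holomorphic_on ball 0 1"
    and inj: "inj_on f (ball 0 1)"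
    and K: "compact K" "convex K"
    and bd: "f ` sphere 0 1 \<subseteq> K" "f ` sphere 0 1 \<inter> interior K = {}"
  shows "f ` ball 0 1 = interior K"
proof -
  let ?D = "ball 0 1 :: complex set"
  have "f z \<in> K" if z: "z \<in> ?D" for z
  proof (rule ccontr)
    assume "f z \<notin> K"
    then obtain a b where ab: "inner a (f z) < b" "\<And>x. x \<in> K \<Longrightarrow> inner a x > b"
      using separating_hyperplane_closed_point[of K "f z"] K compact_imp_closed by blast
    \<comment> \<open>\<open>exp\<close> turns the separating half-plane into a disk, so the maximum modulus principle applies\<close>
    define E where "E w = exp (- (cnj a * f w))" for w
    have nE: "norm (E w) = exp (- inner a (f w))" for w
      by (simp add: E_def norm_exp_eq_Re inner_complex_def)
    have "norm (E z) \<le> exp (- b)"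
    proof (rule maximum_modulus_frontier[of E "cball 0 1"])
      show "E holomorphic_on interior (cball 0 1)"
        unfolding E_def using hol by (auto intro!: holomorphic_intros)
      show "continuous_on (closure (cball 0 1)) E"
        unfolding E_def using cont by (auto intro!: continuous_intros)
      fix w :: complex assume "w \<in> frontier (cball 0 1)"
      then have "f w \<in> K" using bd(1) by auto
      then show "norm (E w) \<le> exp (- b)" using ab(2)[of "f w"] by (simp add: nE)
    qed (use z in auto)
    then show False using ab(1) by (simp add: nE)
  qed
  then have "f ` ?D \<subseteq> K" by auto
  moreover have op: "open (f ` ?D)"
    using cont by (intro invariance_of_domain inj) (auto intro: continuous_on_subset)
  ultimately have sub: "f ` ?D \<subseteq> interior K" by (intro interior_maximal)
  have "compact (f ` cball 0 1)"
    using cont by (intro compact_continuous_image) auto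
  moreover have "cball 0 1 = ?D \<union> sphere 0 1" by auto
  ultimately have "closed (f ` ?D \<union> f ` sphere 0 1)"
    by (metis compact_imp_closed image_Un)
  moreover have "f ` ?D = interior K \<inter> (f ` ?D \<union> f ` sphere 0 1)"
    using sub bd(2) by blast
  ultimately have "closedin (top_of_set (interior K)) (f ` ?D)"
    by (metis closedin_closed_Int)
  moreover have "openin (top_of_set (interior K)) (f ` ?D)"
    using op sub by (metis open_subset)
  moreover have "connected (interior K)"
    using K by (simp add: convex_connected)
  ultimately have "f ` ?D = {} \<or> f ` ?D = interior K"
    unfolding connected_clopen by blast
  then show ?thesis by simp
qed

section \<open>Edges of a regular polygon\<close>

text \<open>Evenness and periodicity of the cosine move the angle into the interval from
  \<open>pi / n\<close> to \<open>pi\<close>, where the cosine decreases: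
  \<open>\<bar>m\<bar>\<close> is kept if it is at most \<open>n\<close> and replaced by
  \<open>2 * n - \<bar>m\<bar>\<close> otherwise.\<close>

lemma cos_odd_multiple_le:
  fixes n :: nat and m :: int
  assumes "n > 0" "odd m" "\<bar>m\<bar> < 2 * int n"
  shows "cos (pi * of_int m / n) \<le> cos (pi / n)"
proof -
  define k where "k = \<bar>m\<bar>"
  have "m \<noteq> 0" using \<open>odd m\<close> by auto
  then have k: "1 \<le> k" "k < 2 * int n" using assms(3) unfolding k_def by linarith+
  have "cos (pi * of_int m / n) = cos (pi * of_int k / n)"
    unfolding k_def by (cases "m \<ge> 0") auto
  also have "\<dots> \<le> cos (pi / n)"
  proof (cases "k \<le> int n")
    case True
    then have "real_of_int k \<le> n" by linarith
    then show ?thesis using k(1) \<open>n > 0\<close>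
      by (intro cos_monotone_0_pi_le) (auto simp: field_simps)
  next
    case False
    have "cos (pi * of_int k / n) = cos (2 * pi - pi * of_int k / n)"
      by (simp add: cos_diff)
    also have "2 * pi - pi * of_int k / n = pi * of_int (2 * int n - k) / n"
      using \<open>n > 0\<close> by (simp add: field_simps)
    also have "cos (pi * of_int (2 * int n - k) / n) \<le> cos (pi / n)"
    proof (rule cos_monotone_0_pi_le)
      have "real_of_int (2 * int n - k) \<le> n" "real_of_int (2 * int n - k) \<ge> 1"
        using False k by linarith+
      then show "pi / n \<le> pi * of_int (2 * int n - k) / n"
          "pi * of_int (2 * int n - k) / n \<le> pi"
        using \<open>n > 0\<close> mult_left_mono[of 1 "real_of_int (2 * int n - k)" pi]
        by (auto simp: divide_le_eq divide_right_mono simp del: of_int_diff)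
    qed simp
    finally show ?thesis .
  qed
  finally show ?thesis .
qed

text \<open>The line through an edge supports the polygon: every vertex lies on its inner side, so
  the edge misses the interior.\<close>

lemma regular_polygon_edge:
  fixes r :: real
  assumes "r > 0" "n > 0" "j < n"
    and x: "x \<in> closed_segment (of_real r * cis (2 * pi * real j / n))
                              (of_real r * cis (2 * pi * real (Suc j) / n))"
  defines "H \<equiv> convex hull {of_real r * cis (2 * pi * real k / n) |k. k < n}"
  shows "x \<in> H" and "x \<notin> interior H"
proof -
  let ?V = "{of_real r * cis (2 * pi * real k / n) |k. k < n}"
  \<comment> \<open>For \<open>j = n - 1\<close> the second endpoint wraps around to vertex
    0.\<close>
  have v1: "of_real r * cis (2 * pi * real (Suc j) / n) \<in> ?V"
  proof (cases "Suc j < n")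
    case False
    then have "Suc j = n" using \<open>j < n\<close> by simp
    then have "2 * pi * real (Suc j) / n = 2 * pi" using \<open>n > 0\<close> by simp
    then have "of_real r * cis (2 * pi * real (Suc j) / n) = of_real r * cis (2 * pi * real 0 / n)"
      by simp
    then show ?thesis using \<open>n > 0\<close> by blast
  qed blast
  have v0: "of_real r * cis (2 * pi * real j / n) \<in> ?V" using \<open>j < n\<close> by blast
  show "x \<in> H"
    unfolding H_def using closed_segment_subset[OF hull_inc[OF v0] hull_inc[OF v1] convex_convex_hull] x
    by blast
  \<comment> \<open>\<open>a\<close> is the unit vector at the angle halfway between the endpoints,
    normal to the edge, and \<open>d\<close> is the signed distance of the edge line from the
    centre.\<close>
  define a where "a = cis ((2 * real j + 1) * pi / n)"
  define d where "d = r * cos (pi / n)"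
  have ip: "inner a (of_real r * cis t) = r * cos (t - (2 * real j + 1) * pi / n)" for t
    by (simp add: a_def inner_complex_def cos_diff algebra_simps)
  have le: "inner a (of_real r * cis (2 * pi * real k / n)) \<le> d" if "k < n" for k
  proof -
    \<comment> \<open>Seen from the direction \<open>a\<close>, vertex \<open>k\<close> lies at an
      odd multiple of \<open>pi / n\<close>.\<close>
    have "2 * pi * real k / n - (2 * real j + 1) * pi / n
        = pi * of_int (2 * (int k - int j) - 1) / n"
      using \<open>n > 0\<close> by (simp add: field_simps)
    moreover have "cos (pi * of_int (2 * (int k - int j) - 1) / n) \<le> cos (pi / n)"
      by (rule cos_odd_multiple_le) (use that \<open>j < n\<close> in auto)
    ultimately show ?thesis unfolding ip d_def using \<open>r > 0\<close> by simp
  qed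
  have "H \<subseteq> {y. inner a y \<le> d}"
    unfolding H_def by (rule hull_minimal) (use le in \<open>auto simp: convex_halfspace_le\<close>)
  then have "interior H \<subseteq> {y. inner a y < d}"
    using interior_mono[of H "{y. inner a y \<le> d}"] by (simp add: a_def interior_halfspace_le)
  moreover have "inner a (of_real r * cis (2 * pi * real j / n)) = d"
      "inner a (of_real r * cis (2 * pi * real (Suc j) / n)) = d"
  proof -
    have "2 * pi * real j / n - (2 * real j + 1) * pi / n = - (pi / n)"
      "2 * pi * real (Suc j) / n - (2 * real j + 1) * pi / n = pi / n"
      using \<open>n > 0\<close> by (simp_all add: field_simps)
    then show "inner a (of_real r * cis (2 * pi * real j / n)) = d"
      "inner a (of_real r * cis (2 * pi * real (Suc j) / n)) = d"
      unfolding ip d_def by simp_all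
  qed
  then have "inner a x = d"
    using x by (auto simp only: in_segment inner_add_right inner_scaleR_right left_diff_distrib)
  ultimately show "x \<notin> interior H" by auto
qed

section \<open>The polygon map on the closed disk\<close>

text \<open>With \<^term>\<open>T k = pochhammer s k / fact k\<close> one has \<^term>\<open>T k - T (Suc k) = (1 - s) * (T k / Suc k)\<close>,
  so the series telescopes.\<close>

lemma summable_pochhammer_over_Suc:
  fixes s :: real
  assumes "0 \<le> s" "s < 1"
  shows "summable (\<lambda>k. pochhammer s k / fact k / real (Suc k))"
proof -
  define T where "T k = pochhammer s k / fact k" for k
  have T0: "T k \<ge> 0" for k
    unfolding T_def using assms by (simp add: pochhammer_nonneg pochhammer_prod prod_nonneg)
  have diff: "T k - T (Suc k) = (1 - s) * (T k / real (Suc k))" for k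
  proof -
    have "T (Suc k) = T k * (s + real k) / (1 + real k)"
      by (simp add: T_def pochhammer_Suc)
    moreover have "1 + real k \<noteq> 0" by linarith
    ultimately show ?thesis by (simp add: field_simps)
  qed
  have "decseq T"
    by (rule decseq_SucI) (use diff T0 assms in \<open>metis diff_ge_0_iff_ge divide_nonneg_nonneg less_imp_le mult_nonneg_nonneg of_nat_0_le_iff\<close>)
  then obtain L where "T \<longlonglongrightarrow> L" using decseq_convergent T0 by metis
  then have "summable (\<lambda>k. (1 - s) * (T k / real (Suc k)))"
    unfolding diff[symmetric] by (rule telescope_summable')
  then have "summable (\<lambda>k. T k / real (Suc k))"
    using assms by (subst (asm) summable_cmult_iff) simp
  then show ?thesis by (simp add: T_def)
qed

text \<open>The Taylor series of the paper's \<open>\<phi>\<close>; unlike the integral it also makes sense at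
  the vertices, i.e. at the \<open>n\<close>-th roots of unity.\<close>

definition polygon_map :: "nat \<Rightarrow> complex \<Rightarrow> complex" where
  "polygon_map n z = z *
     (\<Sum>k. (pochhammer (2 / of_nat n) k / fact k) / of_nat (1 + n * k) * (z ^ n) ^ k)"

text \<open>The value of the series at the vertex 1, which is the circumradius of the image
  polygon.\<close>

definition polygon_radius :: "nat \<Rightarrow> real" where
  "polygon_radius n = (\<Sum>k. pochhammer (2 / real n) k / fact k / real (1 + n * k))"

text \<open>For \<open>n \<ge> 3\<close> the parameter \<open>2 / n\<close> is below 1 and
  \<open>1 + n * k\<close> is at least \<open>Suc k\<close>, so the preceding series is a
  majorant.\<close>

lemma pochhammer_over_progression:
  assumes "n \<ge> 3"
  shows "summable (\<lambda>k. pochhammer (2 / real n) k / fact k / real (1 + n * k))"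
    and "pochhammer (2 / real n) k / fact k / real (1 + n * k) > 0"
proof -
  have pos: "pochhammer (2 / real n) k > 0" for k
    using assms by (intro pochhammer_pos) simp
  then show "pochhammer (2 / real n) k / fact k / real (1 + n * k) > 0"
    by (intro divide_pos_pos) (auto simp del: of_nat_Suc)
  show "summable (\<lambda>k. pochhammer (2 / real n) k / fact k / real (1 + n * k))"
  proof (rule summable_comparison_test'[OF summable_pochhammer_over_Suc[of "2 / real n"], where N = 0])
    fix k
    have "Suc k \<le> 1 + n * k" using assms by (cases n) auto
    then have "real (Suc k) \<le> real (1 + n * k)" by (rule of_nat_mono)
    then show "norm (pochhammer (2 / real n) k / fact k / real (1 + n * k))
        \<le> pochhammer (2 / real n) k / fact k / real (Suc k)"
      using pos[of k] by (simp add: frac_le less_imp_le del: of_nat_Suc of_nat_add)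
  qed (use assms in auto)
qed

lemma polygon_coeff_of_real:
  "(pochhammer (2 / of_nat n) k / fact k) / of_nat (1 + n * k) =
     (of_real (pochhammer (2 / real n) k / fact k / real (1 + n * k)) :: complex)"
proof -
  have "pochhammer (2 / of_nat n) k = (of_real (pochhammer (2 / real n) k) :: complex)"
    by (simp add: pochhammer_of_real[symmetric])
  then show ?thesis by simp
qed

lemma polygon_map_1:
  assumes "n \<ge> 3"
  shows "polygon_map n 1 = of_real (polygon_radius n)" and "polygon_radius n > 0"
proof -
  show "polygon_radius n > 0"
    unfolding polygon_radius_def using pochhammer_over_progression[OF assms] by (intro suminf_pos)
  show "polygon_map n 1 = of_real (polygon_radius n)"
    unfolding polygon_map_def polygon_coeff_of_real polygon_radius_def
    using suminf_of_real[OF pochhammer_over_progression(1)[OF assms], where 'a = complex]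
    by (simp only: power_one mult_1 mult_1_right)
qed

text \<open>Apart from the leading factor \<open>z\<close>, the series sees only
  \<open>z ^ n\<close>. This symmetry reduces the circle to a single arc.\<close>

lemma polygon_map_rotate:
  assumes "\<zeta> ^ n = 1"
  shows "polygon_map n (\<zeta> * z) = \<zeta> * polygon_map n z"
  using assms by (simp add: polygon_map_def power_mult_distrib)

text \<open>The positive coefficients are themselves summable and serve as majorants in the
  Weierstrass test, including on the circle.\<close>

lemma continuous_on_polygon_map:
  assumes "n \<ge> 3"
  shows "continuous_on (cball 0 1) (polygon_map n)"
proof -
  have "uniform_limit (cball 0 1)
    (\<lambda>m z. \<Sum>k<m. (pochhammer (2 / of_nat n) k / fact k) / of_nat (1 + n * k) * (z ^ n) ^ k)
    (\<lambda>z. \<Sum>k. (pochhammer (2 / of_nat n) k / fact k) / of_nat (1 + n * k) * (z ^ n) ^ k :: complex)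
    sequentially"
  proof (rule Weierstrass_m_test[OF _ pochhammer_over_progression(1)[OF assms]])
    fix k and z :: complex assume "z \<in> cball 0 1"
    then have "norm ((z ^ n) ^ k) \<le> 1" by (simp add: norm_power power_le_one)
    then show "norm ((pochhammer (2 / of_nat n) k / fact k) / of_nat (1 + n * k) * (z ^ n) ^ k)
        \<le> pochhammer (2 / real n) k / fact k / real (1 + n * k)"
      using pochhammer_over_progression(2)[OF assms, of k]
      unfolding polygon_coeff_of_real norm_mult norm_of_real
      by (metis abs_of_pos less_imp_le mult_left_le)
  qed
  then have "continuous_on (cball 0 1)
    (\<lambda>z. \<Sum>k. (pochhammer (2 / of_nat n) k / fact k) / of_nat (1 + n * k) * (z ^ n) ^ k :: complex)"
    by (rule uniform_limit_theorem[rotated])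
      (simp, intro always_eventually allI continuous_on_sum continuous_on_mult continuous_on_const
        continuous_on_power continuous_on_id)
  then show ?thesis
    unfolding polygon_map_def by (intro continuous_intros)
qed

lemma has_field_derivative_polygon_map:
  assumes "n > 0" "norm z < 1"
  shows "(polygon_map n has_field_derivative (1 - z ^ n) powr (- 2 / of_nat n)) (at z)"
proof -
  have bin: "(\<lambda>k. pochhammer (2 / of_nat n) k / fact k * w ^ k) sums (1 - w) powr (- 2 / of_nat n)"
    if "norm w < 1" for w :: complex
    using binomial_series_pochhammer[OF that, of "2 / of_nat n"] by simp
  have "norm (z ^ n) < 1" using assms by (simp add: norm_power power_less_one_iff)
  from sums_unique[OF bin[OF this]] show ?thesis
    unfolding polygon_map_def[abs_def]
    using has_field_derivative_arith_progression_series[of "\<lambda>k. pochhammer (2 / of_nat n) k / fact k" 1 n z]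
      bin assms by (auto simp: sums_iff)
qed

text \<open>The argument of \<open>w\<close> is below \<open>pi / 2\<close> in modulus, and scaling
  it by \<open>s\<close> keeps it there.\<close>

lemma Re_powr_pos:
  fixes w :: complex
  assumes "Re w > 0" "\<bar>s\<bar> \<le> 1"
  shows "Re (w powr of_real s) > 0"
proof -
  have "\<bar>s * Im (Ln w)\<bar> < pi / 2"
  proof -
    have "\<bar>Im (Ln w)\<bar> < pi / 2" using assms Re_Ln_pos_lt_imp by blast
    then show ?thesis
      using assms(2) mult_left_le_one_le[of "\<bar>Im (Ln w)\<bar>" "\<bar>s\<bar>"] by (simp add: abs_mult)
  qed
  then have "cos (s * Im (Ln w)) > 0" by (intro cos_gt_zero_pi) auto
  moreover have "w \<noteq> 0" using assms by auto
  ultimately show ?thesis by (simp add: powr_def Re_exp)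
qed

text \<open>This is the Noshiro-Warschawski criterion: a holomorphic function on a convex domain
  whose derivative has positive real part is injective.\<close>

lemma inj_on_polygon_map:
  assumes "n \<ge> 3"
  shows "inj_on (polygon_map n) (ball 0 1)"
proof (rule inj_onI, rule ccontr)
  fix a b :: complex
  assume ab: "a \<in> ball 0 1" "b \<in> ball 0 1" "polygon_map n a = polygon_map n b" "a \<noteq> b"
  define f' where "f' z = (1 - z ^ n) powr (- 2 / of_nat n)" for z :: complex
  have seg: "closed_segment a b \<subseteq> ball 0 1"
    using ab by (intro closed_segment_subset) auto
  \<comment> \<open>The factor \<open>cnj (b - a)\<close> turns the increment into the derivative
    times the positive number \<open>(norm (b - a))\<^sup>2\<close>.\<close>
  have "\<exists>u. u \<in> closed_segment a b \<and>
      Re (cnj (b - a) * polygon_map n b) - Re (cnj (b - a) * polygon_map n a)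
        = Re (cnj (b - a) * f' u * (b - a))"
  proof (rule complex_mvt_line)
    fix u assume "u \<in> closed_segment a b"
    then show "((\<lambda>z. cnj (b - a) * polygon_map n z) has_field_derivative cnj (b - a) * f' u) (at u)"
      unfolding f'_def using seg assms
      by (intro DERIV_cmult has_field_derivative_polygon_map) auto
  qed
  then obtain u where u: "u \<in> closed_segment a b" "Re (cnj (b - a) * f' u * (b - a)) = 0"
    using ab(3) by auto
  have "cnj (b - a) * f' u * (b - a) = of_real ((norm (b - a))\<^sup>2) * f' u"
    by (simp only: complex_norm_square mult_ac)
  then have "(norm (b - a))\<^sup>2 * Re (f' u) = 0"
    using u(2) by (simp only: times_complex.sel Re_complex_of_real Im_complex_of_real)
  moreover have "Re (f' u) > 0"
  proof -
    have "norm (u ^ n) < 1"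
      using u(1) seg assms by (auto simp: norm_power power_less_one_iff)
    then have "Re (1 - u ^ n) > 0"
      using complex_Re_le_cmod[of "u ^ n"] by simp
    then show ?thesis
      unfolding f'_def using Re_powr_pos[of "1 - u ^ n" "- 2 / real n"] assms by simp
  qed
  ultimately show False using ab(4) by simp
qed

section \<open>Continuation across the circle and the boundary arcs\<close>

text \<open>For \<open>n > 0\<close> this is the plane cut along the rays that run outward from the
  \<open>n\<close>-th roots of unity; the principal branch of the integrand is holomorphic
  there.\<close>

definition slit_domain :: "nat \<Rightarrow> complex set" where
  "slit_domain n = {z. 1 - z ^ n \<notin> \<real>\<^sub>\<le>\<^sub>0}"

lemma open_slit_domain: "open (slit_domain n)"
proof -
  have "open ((\<lambda>z::complex. 1 - z ^ n) -` (- \<real>\<^sub>\<le>\<^sub>0))"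
    by (intro open_vimage continuous_intros) auto
  then show ?thesis by (simp add: slit_domain_def vimage_def)
qed

text \<open>If \<open>(t * z) ^ n\<close> is real and at least 1, then division by
  \<open>t ^ n\<close>, which is at most 1, shows the same of \<open>z ^ n\<close>. Hence the slit
  domain is star-shaped about 0.\<close>

lemma slit_domain_scale:
  assumes "z \<in> slit_domain n" "0 \<le> t" "t \<le> 1"
  shows "of_real t * z \<in> slit_domain n"
proof (rule ccontr)
  assume "of_real t * z \<notin> slit_domain n"
  then obtain x where x: "1 - of_real (t ^ n) * z ^ n = of_real x" "x \<le> 0"
    by (auto simp: slit_domain_def power_mult_distrib elim: nonpos_Reals_cases)
  define s where "s = t ^ n"
  have eq: "of_real s * z ^ n = of_real (1 - x)"
    using x(1) by (simp add: s_def algebra_simps)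
  have "s \<noteq> 0" using eq x(2) by auto
  moreover have "0 \<le> s" "s \<le> 1" using assms by (auto simp: s_def power_le_one)
  ultimately have s: "0 < s" "s \<le> 1" by auto
  then have "z ^ n = of_real ((1 - x) / s)"
    using eq by (simp add: eq_divide_eq mult.commute)
  then have "1 - z ^ n = of_real (1 - (1 - x) / s)" by simp
  moreover have "1 - (1 - x) / s \<le> 0"
    using s x(2) by (simp add: le_divide_eq)
  ultimately show False using assms(1) by (simp add: slit_domain_def del: of_real_diff)
qed

text \<open>A primitive on the slit domain provides derivatives at circle points, which the power
  series gives only inside the disk. Both functions differ by a constant in the disk, and continuity
  carries this to the circle.\<close>

lemma polygon_map_extension:
  assumes "n \<ge> 3"
  obtains F where
    "\<And>z. z \<in> slit_domain n \<Longrightarrow> (F has_field_derivative (1 - z ^ n) powr (- 2 / of_nat n)) (at z)"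
    "\<And>z. z \<in> slit_domain n \<Longrightarrow> norm z \<le> 1 \<Longrightarrow> polygon_map n z = F z"
proof -
  let ?f = "\<lambda>z::complex. (1 - z ^ n) powr (- 2 / of_nat n)"
  have fd: "?f field_differentiable at z" if "z \<in> slit_domain n" for z
    using that unfolding slit_domain_def field_differentiable_def
    by (auto intro!: exI derivative_eq_intros)
  have 0: "0 \<in> slit_domain n"
    using assms by (simp add: slit_domain_def power_0_left complex_nonpos_Reals_iff)
  have star: "starlike (slit_domain n)"
    unfolding starlike_def
  proof (intro bexI[OF _ 0] ballI subsetI)
    fix z x assume "z \<in> slit_domain n" "x \<in> closed_segment 0 z"
    then show "x \<in> slit_domain n"
      using slit_domain_scale by (auto simp: in_segment scaleR_conv_of_real)
  qed
  have "\<exists>g. \<forall>x\<in>slit_domain n. (g has_field_derivative ?f x) (at x)"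
    by (rule holomorphic_starlike_primitive[OF _ star open_slit_domain, of _ "{}"])
      (use fd in \<open>auto intro!: continuous_at_imp_continuous_on field_differentiable_imp_continuous_at\<close>)
  then obtain g where g: "\<And>z. z \<in> slit_domain n \<Longrightarrow> (g has_field_derivative ?f z) (at z)"
    by blast
  have disc: "z \<in> slit_domain n" if "norm z < 1" for z
  proof -
    have "norm (z ^ n) < 1" using that assms by (simp add: norm_power power_less_one_iff)
    then have "Re (1 - z ^ n) > 0" using complex_Re_le_cmod[of "z ^ n"] by simp
    then show ?thesis by (auto simp: slit_domain_def complex_nonpos_Reals_iff)
  qed
  have "\<exists>c. \<forall>z\<in>ball 0 1. polygon_map n z - g z = c"
  proof (rule has_field_derivative_zero_constant)
    fix z :: complex assume "z \<in> ball 0 1"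
    then show "((\<lambda>z. polygon_map n z - g z) has_field_derivative 0) (at z within ball 0 1)"
      using has_field_derivative_at_within[OF DERIV_diff[OF
            has_field_derivative_polygon_map[of n z] g[of z]]] disc[of z] assms
      by auto
  qed simp
  then obtain c where c: "\<And>z. norm z < 1 \<Longrightarrow> polygon_map n z - g z = c" by auto
  show ?thesis
  proof (rule that[of "\<lambda>z. g z + c"])
    fix z assume z: "z \<in> slit_domain n"
    show "((\<lambda>z. g z + c) has_field_derivative ?f z) (at z)"
      using DERIV_add[OF g[OF z] DERIV_const[of c]] by simp
    assume nz: "norm z \<le> 1"
    have "continuous_on (slit_domain n) g"
      using g by (auto intro!: continuous_at_imp_continuous_on DERIV_isCont)
    moreover have line: "continuous_on {0..1} (\<lambda>t. of_real t * z)"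
      by (intro continuous_intros)
    ultimately have "continuous_on {0..1} (\<lambda>t. g (of_real t * z))"
      by (rule continuous_on_compose2) (use slit_domain_scale[OF z] in auto)
    moreover have "continuous_on {0..1} (\<lambda>t. polygon_map n (of_real t * z))"
      by (rule continuous_on_compose2[OF continuous_on_polygon_map[OF assms] line])
        (use nz in \<open>auto simp: norm_mult mult_le_one\<close>)
    ultimately have "continuous_on {0..1} (\<lambda>t. polygon_map n (of_real t * z) - g (of_real t * z))"
      by (intro continuous_on_diff)
    \<comment> \<open>For \<open>t < 1\<close> the radius stays in the open disk; the endpoint
      \<open>t = 1\<close> follows by continuity.\<close>
    moreover have "polygon_map n (of_real t * z) - g (of_real t * z) = c" if "t \<in> {0<..<1}" for t
    proof (rule c)
      have "t * norm z \<le> t" "t < 1" using that nz by (auto simp: mult_left_le)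
      then have "t * norm z < 1" by linarith
      then show "norm (of_real t * z) < 1" using that by (simp add: norm_mult)
    qed
    moreover have "closure {0<..<1::real} = {0..1}" by simp
    ultimately have "polygon_map n (of_real 1 * z) - g (of_real 1 * z) = c"
      using continuous_constant_on_closure[of "{0<..<1::real}"
          "\<lambda>t. polygon_map n (of_real t * z) - g (of_real t * z)" c 1]
      by (metis atLeastAtMost_iff order_refl zero_le_one)
    then show "polygon_map n z = g z + c" by (simp add: algebra_simps)
  qed
qed

text \<open>The left-hand side of the second claim is the derivative of \<open>\<theta> \<mapsto> \<phi> (cis \<theta>)\<close>: its direction is
  constant along each arc between consecutive \<open>n\<close>-th roots of unity.\<close>

lemma boundary_direction:
  fixes n :: nat
  assumes "n > 0" "0 < \<theta>" "\<theta> < 2 * pi / n"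
  shows "cis \<theta> \<in> slit_domain n"
    and "\<exists>c>0. (1 - cis \<theta> ^ n) powr (- 2 / of_nat n) * (\<i> * cis \<theta>) = of_real c * (\<i> * cis (pi / n))"
proof -
  define t where "t = n * \<theta> / 2"
  have t: "0 < t" "t < pi" using assms by (auto simp: t_def field_simps)
  then have st: "sin t > 0" by (rule sin_gt_zero)
  have "cis \<theta> ^ n = cis (2 * t)" by (simp add: Complex.DeMoivre t_def)
  \<comment> \<open>Polar form: for \<open>0 < t < pi\<close> the modulus is positive and the
    argument lies strictly between \<open>- pi / 2\<close> and \<open>pi / 2\<close>, so the
    principal logarithm is explicit.\<close>
  moreover have "1 - cis (2 * t) = of_real (2 * sin t) * cis (t - pi / 2)"
    by (auto simp: complex_eq_iff cos_diff sin_diff cos_double_sin sin_double power2_eq_square)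
  moreover have "exp (ln (2 * sin t)) = 2 * sin t"
    using st by simp
  ultimately have E: "1 - cis \<theta> ^ n = exp (Complex (ln (2 * sin t)) (t - pi / 2))"
    by (simp only: exp_eq_polar complex.sel)
  have Ln: "Ln (1 - cis \<theta> ^ n) = Complex (ln (2 * sin t)) (t - pi / 2)"
    unfolding E by (rule Ln_exp) (use t in auto)
  show "cis \<theta> \<in> slit_domain n"
  proof -
    have "Re (1 - cis \<theta> ^ n) > 0"
      unfolding E Re_exp using st t by (auto intro!: mult_pos_pos cos_gt_zero_pi)
    then show ?thesis by (auto simp: slit_domain_def complex_nonpos_Reals_iff)
  qed
  have "1 - cis \<theta> ^ n \<noteq> 0" unfolding E by simp
  then have "(1 - cis \<theta> ^ n) powr (- 2 / of_nat n)
      = exp (of_real (- 2 / n) * Complex (ln (2 * sin t)) (t - pi / 2))"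
    by (simp add: powr_def Ln)
  \<comment> \<open>The power contributes the argument \<open>pi / n - \<theta>\<close>, and the
    tangent factor \<open>cis \<theta>\<close> cancels its dependence on
    \<open>\<theta>\<close>.\<close>
  also have "of_real (- 2 / n) * Complex (ln (2 * sin t)) (t - pi / 2)
      = of_real (- 2 / n * ln (2 * sin t)) + \<i> * of_real (pi / n - \<theta>)"
    using assms(1) by (simp add: complex_eq_iff t_def field_simps)
  also have "exp \<dots> = of_real (exp (- 2 / n * ln (2 * sin t))) * cis (pi / n - \<theta>)"
    by (simp only: exp_add exp_of_real cis_conv_exp)
  finally have "(1 - cis \<theta> ^ n) powr (- 2 / of_nat n) * (\<i> * cis \<theta>)
      = of_real (exp (- 2 / n * ln (2 * sin t))) * (\<i> * (cis (pi / n - \<theta>) * cis \<theta>))"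
    by (simp only: mult_ac)
  also have "cis (pi / n - \<theta>) * cis \<theta> = cis (pi / n)" by (simp add: cis_mult)
  finally show "\<exists>c>0. (1 - cis \<theta> ^ n) powr (- 2 / of_nat n) * (\<i> * cis \<theta>)
      = of_real c * (\<i> * cis (pi / n))"
    by (intro exI[of _ "exp (- 2 / n * ln (2 * sin t))"]) simp
qed

text \<open>After rotation by \<open>cnj u\<close> the boundary curve has positive real velocity
  inside the arc: its imaginary part is constant and its real part increases, so it stays between
  its endpoints.\<close>

lemma polygon_map_arc:
  assumes n: "n \<ge> 3" and \<theta>: "0 \<le> \<theta>" "\<theta> \<le> 2 * pi / n"
  shows "polygon_map n (cis \<theta>) \<in>
    closed_segment (polygon_map n 1) (polygon_map n (cis (2 * pi / n)))"
proof -
  let ?b = "2 * pi / real n"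
  define u where "u = \<i> * cis (pi / n)"
  have uu: "cnj u * u = 1" by (simp add: u_def cis_mult cis_cnj mult.commute mult.left_commute)
  define q where "q t = cnj u * polygon_map n (cis t)" for t
  have b: "0 < ?b" using n by simp
  have contq: "continuous_on {0..?b} q"
    unfolding q_def
    by (intro continuous_intros continuous_on_compose2[OF continuous_on_polygon_map[OF n]]) auto
  obtain F where F:
    "\<And>z. z \<in> slit_domain n \<Longrightarrow> (F has_field_derivative (1 - z ^ n) powr (- 2 / of_nat n)) (at z)"
    "\<And>z. z \<in> slit_domain n \<Longrightarrow> norm z \<le> 1 \<Longrightarrow> polygon_map n z = F z"
    using polygon_map_extension[OF n] by blast
  have dq: "\<exists>c>0. (q has_vector_derivative of_real c) (at t)" if t: "0 < t" "t < ?b" for t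
  proof -
    have n0: "n > 0" using n by simp
    obtain c where c: "c > 0"
      "(1 - cis t ^ n) powr (- 2 / of_nat n) * (\<i> * cis t) = of_real c * u"
      using boundary_direction(2)[OF n0 t] unfolding u_def by blast
    have "((\<lambda>t. cis t) has_vector_derivative \<i> * cis t) (at t)"
      unfolding cis_conv_exp
      by (auto intro!: derivative_eq_intros has_vector_derivative_real_field)
    from field_vector_diff_chain_at[OF this F(1)[OF boundary_direction(1)[OF n0 t]]]
    have "((\<lambda>t. F (cis t)) has_vector_derivative of_real c * u) (at t)"
      using c(2) by (simp add: o_def mult.commute)
    then have "((\<lambda>t. cnj u * F (cis t)) has_vector_derivative cnj u * (of_real c * u)) (at t)"
      by (rule has_vector_derivative_mult_right)
    also have "cnj u * (of_real c * u) = of_real c"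
      using uu by (metis mult.left_commute mult.right_neutral)
    finally have "((\<lambda>t. cnj u * F (cis t)) has_vector_derivative of_real c) (at t)" .
    then have "(q has_vector_derivative of_real c) (at t)"
    proof (rule has_vector_derivative_transform_within_open)
      show "open {0<..<?b}" "t \<in> {0<..<?b}" using t by auto
      fix x assume "x \<in> {0<..<?b}"
      then show "cnj u * F (cis x) = q x"
        unfolding q_def using F(2)[OF boundary_direction(1)[OF n0, of x]] by simp
    qed
    then show ?thesis using c(1) by blast
  qed
  \<comment> \<open>The derivative is known only inside the arc, since its ends are roots of unity;
    continuity of \<open>q\<close> covers the ends.\<close>
  have mono: "Re (q s) \<le> Re (q t)" if "0 \<le> s" "s \<le> t" "t \<le> ?b" for s t
  proof (rule DERIV_nonneg_imp_increasing_open[OF that(2)])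
    fix x assume "s < x" "x < t"
    then obtain c where "c > 0" "(q has_vector_derivative of_real c) (at x)"
      using dq[of x] \<open>0 \<le> s\<close> \<open>t \<le> ?b\<close> by auto
    then have "((\<lambda>x. Re (q x)) has_real_derivative c) (at x)"
      unfolding has_real_derivative_iff_has_vector_derivative
      using bounded_linear.has_vector_derivative[OF bounded_linear_Re, of q] by fastforce
    then show "\<exists>y. ((\<lambda>x. Re (q x)) has_real_derivative y) (at x) \<and> y \<ge> 0"
      using \<open>c > 0\<close> by auto
  qed (use that in \<open>auto intro!: continuous_intros continuous_on_subset[OF contq]\<close>)
  have const: "Im (q t) = Im (q 0)" if "0 \<le> t" "t \<le> ?b" for t
  proof (rule DERIV_isconst2[OF b _ _ that])
    fix x assume "0 < x" "x < ?b"
    then obtain c where "c > 0" "(q has_vector_derivative of_real c) (at x)"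
      using dq[of x] by auto
    then show "((\<lambda>x. Im (q x)) has_real_derivative 0) (at x)"
      unfolding has_real_derivative_iff_has_vector_derivative
      using bounded_linear.has_vector_derivative[OF bounded_linear_Im, of q] by fastforce
  qed (intro continuous_intros contq)
  have "Re (q \<theta>) \<in> closed_segment (Re (q 0)) (Re (q ?b))"
    using mono[of 0 \<theta>] mono[of \<theta> ?b] \<theta> b by (simp add: closed_segment_eq_real_ivl)
  then obtain s where s: "0 \<le> s" "s \<le> 1" "Re (q \<theta>) = (1 - s) * Re (q 0) + s * Re (q ?b)"
    by (auto simp: in_segment)
  have "q \<theta> = (1 - s) *\<^sub>R q 0 + s *\<^sub>R q ?b"
    using s(3) const[of \<theta>] const[of ?b] \<theta> b by (simp add: complex_eq_iff left_diff_distrib)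
  then have "u * q \<theta> = (1 - s) *\<^sub>R (u * q 0) + s *\<^sub>R (u * q ?b)"
    by (simp add: distrib_left)
  moreover have "u * q t = polygon_map n (cis t)" for t
  proof -
    have "u * q t = (cnj u * u) * polygon_map n (cis t)"
      by (simp only: q_def mult_ac)
    then show ?thesis by (simp only: uu mult_1)
  qed
  ultimately show ?thesis using s(1,2) by (auto simp: in_segment)
qed

text \<open>Rotation by an \<open>n\<close>-th root of unity carries the arc of \<open>z\<close> to
  the first arc, and its edge to the first edge.\<close>

lemma polygon_map_sphere:
  assumes n: "n \<ge> 3" and z: "z \<in> sphere 0 1"
  defines "K \<equiv> convex hull {of_real (polygon_radius n) * cis (2 * pi * real k / real n) |k. k < n}"
  shows "polygon_map n z \<in> K" "polygon_map n z \<notin> interior K"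
proof -
  have n0: "n > 0" using n by simp
  have "norm z = 1" using z by simp
  then have "z = cis (Arg2pi z)"
    using Arg2pi_eq[of z] by (simp add: cis_conv_exp)
  then obtain \<alpha> where \<alpha>: "0 \<le> \<alpha>" "\<alpha> < 2 * pi" "z = cis \<alpha>"
    using Arg2pi_ge_0[of z] Arg2pi_lt_2pi[of z] by blast
  \<comment> \<open>\<open>j\<close> numbers the arc containing \<open>z\<close>, and
    \<open>\<theta>\<close> is the angle measured from the start of that arc.\<close>
  define j where "j = nat \<lfloor>\<alpha> * n / (2 * pi)\<rfloor>"
  define \<theta> where "\<theta> = \<alpha> - 2 * pi * real j / n"
  have fl: "real j \<le> \<alpha> * n / (2 * pi)" "\<alpha> * n / (2 * pi) < real j + 1"
    using \<alpha>(1) by (auto simp: j_def)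
  have "\<alpha> * n / (2 * pi) < n"
    using \<alpha>(2) n0 by (simp add: field_simps)
  then have "j < n" using fl by linarith
  have "2 * pi * real j \<le> \<alpha> * n" "\<alpha> * n < 2 * pi + 2 * pi * real j"
    using fl by (simp_all add: pos_le_divide_eq pos_divide_less_eq ring_distribs mult_ac)
  then have "2 * pi * real j / n \<le> \<alpha>" "\<alpha> \<le> (2 * pi + 2 * pi * real j) / n"
    using n0 by (simp_all add: pos_le_divide_eq pos_divide_le_eq)
  then have \<theta>: "0 \<le> \<theta>" "\<theta> \<le> 2 * pi / n"
    unfolding \<theta>_def add_divide_distrib by linarith+
  let ?\<zeta> = "cis (2 * pi * real j / n)"
  have "?\<zeta> ^ n = cis (2 * pi * real j)"
    using n0 by (simp add: Complex.DeMoivre)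
  then have rot: "?\<zeta> ^ n = 1"
    by (metis Ints_of_nat cis_multiple_2pi)
  have "cis (2 * pi / n) ^ n = 1" using n0 by (simp add: Complex.DeMoivre)
  then have one: "polygon_map n (cis (2 * pi / n)) = cis (2 * pi / n) * of_real (polygon_radius n)"
    using polygon_map_rotate[of "cis (2 * pi / n)" n 1] polygon_map_1(1)[OF n] by simp
  obtain s where s: "0 \<le> s" "s \<le> 1" "polygon_map n (cis \<theta>) =
      (1 - s) *\<^sub>R of_real (polygon_radius n) + s *\<^sub>R (cis (2 * pi / n) * of_real (polygon_radius n))"
    using polygon_map_arc[OF n \<theta>] unfolding one polygon_map_1(1)[OF n] by (auto simp: in_segment)
  have "z = ?\<zeta> * cis \<theta>" by (simp add: \<alpha>(3) \<theta>_def cis_mult)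
  then have "polygon_map n z = ?\<zeta> * polygon_map n (cis \<theta>)"
    using polygon_map_rotate[OF rot] by simp
  also have "\<dots> = (1 - s) *\<^sub>R (of_real (polygon_radius n) * ?\<zeta>)
      + s *\<^sub>R (of_real (polygon_radius n) * (?\<zeta> * cis (2 * pi / n)))"
    unfolding s(3) by (simp add: distrib_left mult_ac scaleR_conv_of_real)
  also have "?\<zeta> * cis (2 * pi / n) = cis (2 * pi * real (Suc j) / n)"
    by (simp add: cis_mult add_divide_distrib distrib_left add.commute)
  finally have "polygon_map n z \<in> closed_segment (of_real (polygon_radius n) * ?\<zeta>)
      (of_real (polygon_radius n) * cis (2 * pi * real (Suc j) / n))"
    using s(1,2) by (auto simp: in_segment)
  from regular_polygon_edge[OF polygon_map_1(2)[OF n] n0 \<open>j < n\<close> this, folded K_def]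
  show "polygon_map n z \<in> K" "polygon_map n z \<notin> interior K" .
qed

lemma polygon_map_image:
  assumes n: "n \<ge> 3"
  shows "polygon_map n ` ball 0 1 = interior (convex hull
    {of_real (polygon_radius n) * cis (2 * pi * real k / real n) |k. k < n})"
proof -
  define K where "K = convex hull {of_real (polygon_radius n) * cis (2 * pi * real k / real n) |k. k < n}"
  have n0: "n > 0" using n by simp
  have hol: "polygon_map n holomorphic_on ball 0 1"
    unfolding holomorphic_on_open[OF open_ball]
  proof
    fix z :: complex assume "z \<in> ball 0 1"
    then show "\<exists>f'. (polygon_map n has_field_derivative f') (at z)"
      using has_field_derivative_polygon_map[OF n0, of z] by auto
  qed
  have K: "compact K" "convex K"
    unfolding K_def by (auto intro!: finite_imp_compact_convex_hull finite_image_set)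
  note bd = polygon_map_sphere[OF n, folded K_def]
  have "polygon_map n ` sphere 0 1 \<subseteq> K"
    using bd(1) by auto
  moreover have "polygon_map n ` sphere 0 1 \<inter> interior K = {}"
    using bd(2) by (metis disjoint_iff imageE)
  ultimately show ?thesis
    unfolding K_def[symmetric]
    by (rule conformal_image_eq_interior[OF continuous_on_polygon_map[OF n] hol inj_on_polygon_map[OF n] K])
qed

lemma contour_integral_polygon_map:
  assumes "n > 0" "z \<in> ball 0 1"
  shows "contour_integral (linepath 0 z) (\<lambda>\<zeta>. (1 - \<zeta> ^ n) powr (- 2 / of_nat n)) = polygon_map n z"
proof -
  have "closed_segment 0 z \<subseteq> ball 0 1"
    using assms by (intro closed_segment_subset) auto
  moreover have "(polygon_map n has_field_derivative (1 - x ^ n) powr (- 2 / of_nat n))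
      (at x within ball 0 1)" if "x \<in> ball 0 1" for x
    by (rule has_field_derivative_at_within[OF has_field_derivative_polygon_map]) (use assms that in auto)
  ultimately have "((\<lambda>\<zeta>. (1 - \<zeta> ^ n) powr (- 2 / of_nat n)) has_contour_integral
      (polygon_map n (pathfinish (linepath 0 z)) - polygon_map n (pathstart (linepath 0 z))))
      (linepath 0 z)"
    by (intro contour_integral_primitive[of "ball 0 1"] valid_path_linepath)
      (simp_all only: path_image_linepath)
  then show ?thesis
    by (simp add: contour_integral_unique polygon_map_def)
qed

section \<open>The shear of the polygon map\<close>

lemma CHD_convex:
  assumes "convex P" "open P" "P \<noteq> {}"
  shows "CHD P"
proof -
  have "convex {z. Im z = y}" for y
    using convex_hyperplane[of \<i> y] by (simp add: inner_complex_def)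
  then show ?thesis
    using assms by (auto simp: CHD_def is_domain_def intro!: convex_connected convex_Int)
qed

text \<open>Termwise integration identifies each summand of \<open>h\<close> and \<open>g\<close> as
  a primitive; the case needed is \<open>p = 2 * k + 1\<close>.\<close>

lemma has_field_derivative_appell_F1_term:
  assumes "p > 0" "n > 0" "norm z < 1"
  shows "((\<lambda>z. z ^ p / of_nat p *
      appell_F1 (of_nat p / of_nat n) b 1 (1 + of_nat p / of_nat n) (z ^ n) (- (z ^ n)))
    has_field_derivative z ^ (p - 1) * ((1 - z ^ n) powr (- b) / (1 + z ^ n))) (at z)"
proof (rule has_field_derivative_transform_within_open[of _ _ _ "ball 0 1"])
  have w: "norm (z ^ n) < 1" if "norm z < 1" for z :: complex
    using that assms(2) by (simp add: norm_power power_less_one_iff)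
  have "((\<lambda>z. z ^ p * (\<Sum>m. shear_coeff b m / of_nat (p + n * m) * (z ^ n) ^ m))
      has_field_derivative z ^ (p - 1) * (\<Sum>m. shear_coeff b m * (z ^ n) ^ m)) (at z)"
    by (rule has_field_derivative_arith_progression_series[OF sums_summable[OF shear_coeff_sums] assms])
  then show "((\<lambda>z. z ^ p * (\<Sum>m. shear_coeff b m / of_nat (p + n * m) * (z ^ n) ^ m))
      has_field_derivative z ^ (p - 1) * ((1 - z ^ n) powr (- b) / (1 + z ^ n))) (at z)"
    unfolding sums_unique[OF shear_coeff_sums[OF w[OF assms(3)]]] .
  fix z :: complex assume "z \<in> ball 0 1"
  then have "norm z < 1" by simp
  from appell_F1_arith_progression[OF assms(1,2) w[OF this], of b]
  show "z ^ p * (\<Sum>m. shear_coeff b m / of_nat (p + n * m) * (z ^ n) ^ m) =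
      z ^ p / of_nat p *
      appell_F1 (of_nat p / of_nat n) b 1 (1 + of_nat p / of_nat n) (z ^ n) (- (z ^ n))"
    by (simp only: times_divide_eq_left times_divide_eq_right flip: times_divide_eq_right)
qed (use assms in auto)

text \<open>The geometric sum yields \<open>1 - z ^ (2 * n) = (1 - z ^ n) * (1 + z ^ n)\<close>: the
  second factor cancels the denominator and the first raises the exponent by one.\<close>

lemma sum_even_powers_mult_powr:
  fixes z :: complex
  assumes "n > 0" "norm z < 1"
  shows "(1 - z\<^sup>2) * ((\<Sum>k<n. z ^ (2 * k)) * ((1 - z ^ n) powr (- (1 + s)) / (1 + z ^ n)))
    = (1 - z ^ n) powr (- s)"
proof -
  have "norm (z ^ n) < 1" using assms by (simp add: norm_power power_less_one_iff)
  then have ne: "1 - z ^ n \<noteq> 0" "1 + z ^ n \<noteq> 0"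
    by (auto simp: add_eq_0_iff)
  have "(1 - z\<^sup>2) * (\<Sum>k<n. z ^ (2 * k)) = 1 - (z\<^sup>2) ^ n"
    by (simp add: one_diff_power_eq power_mult)
  also have "\<dots> = (1 - z ^ n) * (1 + z ^ n)"
    by (simp add: algebra_simps power2_eq_square power_mult_distrib)
  finally have "(1 - z\<^sup>2) * (\<Sum>k<n. z ^ (2 * k)) * (1 - z ^ n) powr (- (1 + s)) / (1 + z ^ n)
      = (1 - z ^ n) * (1 - z ^ n) powr (- (1 + s))"
    using ne by simp
  also have "\<dots> = (1 - z ^ n) powr (1 + - (1 + s))"
    using ne by (simp only: powr_add powr_to_1)
  finally show ?thesis by (simp add: mult.assoc)
qed

theorem theorem3p2:
  fixes n :: nat and \<phi> h g f :: "complex \<Rightarrow> complex"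
  assumes "n \<ge> 3" and "odd n"
    and "\<And>z. z \<in> ball 0 1 \<Longrightarrow>
      \<phi> z = contour_integral (linepath 0 z) (\<lambda>\<zeta>. (1 - \<zeta> ^ n) powr (- 2 / of_nat n))"
    and "\<And>z. z \<in> ball 0 1 \<Longrightarrow>
      h z = (\<Sum>k = 0..n - 1. z ^ (2 * k + 1) / of_nat (2 * k + 1) *
        appell_F1 (of_nat (2 * k + 1) / of_nat n) (1 + 2 / of_nat n) 1
          (1 + of_nat (2 * k + 1) / of_nat n) (z ^ n) (- (z ^ n)))"
    and "\<And>z. z \<in> ball 0 1 \<Longrightarrow>
      g z = (\<Sum>k = 1..n. z ^ (2 * k + 1) / of_nat (2 * k + 1) *
        appell_F1 (of_nat (2 * k + 1) / of_nat n) (1 + 2 / of_nat n) 1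
          (1 + of_nat (2 * k + 1) / of_nat n) (z ^ n) (- (z ^ n)))"
    and "\<And>z. z \<in> ball 0 1 \<Longrightarrow> f z = h z + cnj (g z)"
  shows "(\<exists>P. is_regular_polygon n P \<and> maps_conformally_onto \<phi> (ball 0 1) P)
    \<and> is_harmonic_shear \<phi> (\<lambda>z. z ^ 2) h g f
    \<and> inj_on f (ball 0 1) \<and> CHD (f ` ball 0 1)"
proof -
  let ?D = "ball 0 1 :: complex set"
  have n0: "n > 0" using assms(1) by simp
  have \<phi>: "\<phi> z = polygon_map n z" if "z \<in> ?D" for z
    using assms(3)[OF that] contour_integral_polygon_map[OF n0 that] by simp
  \<comment> \<open>The summand 0 is the centre \<open>c\<close> in
    \<open>is_regular_polygon\<close>.\<close>
  define P where "P = interior (convex hull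
    {0 + of_real (polygon_radius n) * cis (2 * pi * real k / real n) |k. k < n})"
  have poly: "is_regular_polygon n P"
    unfolding is_regular_polygon_def P_def
    using assms(1) polygon_map_1(2)[OF assms(1)]
    by (intro conjI exI[of _ 0] exI[of _ "of_real (polygon_radius n)"]) auto
  have d\<phi>: "(\<phi> has_field_derivative (1 - z ^ n) powr (- 2 / of_nat n)) (at z)" if "z \<in> ?D" for z
    by (rule has_field_derivative_transform_within_open[OF has_field_derivative_polygon_map[OF n0]
          open_ball that]) (use that \<phi> in auto)
  have maps: "maps_conformally_onto \<phi> ?D P"
    unfolding maps_conformally_onto_def
  proof (intro conjI)
    show "\<phi> holomorphic_on ?D"
      unfolding holomorphic_on_open[OF open_ball] using d\<phi> by blast
    show "inj_on \<phi> ?D"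
      using inj_on_polygon_map[OF assms(1)] inj_on_cong[of ?D \<phi> "polygon_map n"] \<phi> by blast
    have "\<phi> ` ?D = polygon_map n ` ?D" by (intro image_cong refl \<phi>)
    then show "\<phi> ` ?D = P"
      using polygon_map_image[OF assms(1)] by (simp add: P_def)
  qed
  then have "P \<noteq> {}" by (auto simp: maps_conformally_onto_def)
  then have CHD_P: "CHD P"
    by (intro CHD_convex) (auto simp: P_def intro: convex_interior convex_convex_hull)
  define B where "B z = (1 - z ^ n) powr (- (1 + 2 / of_nat n)) / (1 + z ^ n)" for z :: complex
  define H where "H z = (\<Sum>k<n. z ^ (2 * k)) * B z" for z
  have summand: "((\<lambda>z. z ^ (2 * k + 1) / of_nat (2 * k + 1) *
        appell_F1 (of_nat (2 * k + 1) / of_nat n) (1 + 2 / of_nat n) 1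
          (1 + of_nat (2 * k + 1) / of_nat n) (z ^ n) (- (z ^ n)))
      has_field_derivative z ^ (2 * k) * B z) (at z)" if "z \<in> ?D" for k z
    using has_field_derivative_appell_F1_term[of "2 * k + 1" n z "1 + 2 / of_nat n"] n0 that
    unfolding B_def by simp
  have dh: "(h has_field_derivative H z) (at z)" if "z \<in> ?D" for z
  proof (rule has_field_derivative_transform_within_open[OF _ open_ball that assms(4)[symmetric]])
    have "{0..n - 1} = {..<n}" using n0 by auto
    then have H: "H z = (\<Sum>k = 0..n - 1. z ^ (2 * k) * B z)"
      by (simp add: H_def sum_distrib_right)
    show "((\<lambda>z. \<Sum>k = 0..n - 1. z ^ (2 * k + 1) / of_nat (2 * k + 1) *
        appell_F1 (of_nat (2 * k + 1) / of_nat n) (1 + 2 / of_nat n) 1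
          (1 + of_nat (2 * k + 1) / of_nat n) (z ^ n) (- (z ^ n)))
        has_field_derivative H z) (at z)"
      unfolding H by (intro DERIV_sum summand that)
  qed
  have dg: "(g has_field_derivative z\<^sup>2 * H z) (at z)" if "z \<in> ?D" for z
  proof (rule has_field_derivative_transform_within_open[OF _ open_ball that assms(5)[symmetric]])
    \<comment> \<open>Multiplication by the dilatation shifts the summation index by one, which
      turns the range of \<open>h\<close> into that of \<open>g\<close>.\<close>
    have "z\<^sup>2 * H z = (\<Sum>k<n. z ^ (2 * Suc k) * B z)"
      by (simp add: H_def sum_distrib_right sum_distrib_left power2_eq_square mult_ac)
    also have "\<dots> = (\<Sum>k = 1..n. z ^ (2 * k) * B z)"
      by (simp only: One_nat_def sum.atLeast1_atMost_eq)
    finally have H: "z\<^sup>2 * H z = (\<Sum>k = 1..n. z ^ (2 * k) * B z)" .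
    show "((\<lambda>z. \<Sum>k = 1..n. z ^ (2 * k + 1) / of_nat (2 * k + 1) *
        appell_F1 (of_nat (2 * k + 1) / of_nat n) (1 + 2 / of_nat n) 1
          (1 + of_nat (2 * k + 1) / of_nat n) (z ^ n) (- (z ^ n)))
        has_field_derivative z\<^sup>2 * H z) (at z)"
      unfolding H by (intro DERIV_sum summand that)
  qed
  have zero: "h 0 = 0" "g 0 = 0" "\<phi> 0 = 0"
    using assms(4,5)[of 0] \<phi>[of 0] by (simp_all add: polygon_map_def)
  \<comment> \<open>Both \<open>h - g\<close> and \<open>\<phi>\<close> have the same derivative in
    the disk and vanish at 0.\<close>
  have "\<exists>c. \<forall>z\<in>?D. h z - g z - \<phi> z = c"
  proof (rule has_field_derivative_zero_constant)
    fix z assume z: "z \<in> ?D"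
    have "(1 - z\<^sup>2) * H z = (1 - z ^ n) powr (- 2 / of_nat n)"
      using sum_even_powers_mult_powr[OF n0, of z "2 / of_nat n"] z
      unfolding H_def B_def by simp
    then have "H z - z\<^sup>2 * H z = (1 - z ^ n) powr (- 2 / of_nat n)"
      by (simp add: left_diff_distrib)
    then show "((\<lambda>z. h z - g z - \<phi> z) has_field_derivative 0) (at z within ?D)"
      using has_field_derivative_at_within[OF DERIV_diff[OF DERIV_diff[OF dh[OF z] dg[OF z]] d\<phi>[OF z]]]
      by simp
  qed simp
  then have hg: "h z - g z = \<phi> z" if "z \<in> ?D" for z
    using that zero by (metis centre_in_ball diff_self eq_iff_diff_eq_0 zero_less_one)
  have "is_harmonic_shear \<phi> (\<lambda>z. z ^ 2) h g f"
    unfolding is_harmonic_shear_def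
  proof (intro conjI ballI exI)
    show "h holomorphic_on ?D" "g holomorphic_on ?D"
      unfolding holomorphic_on_open[OF open_ball] using dh dg by blast+
    fix z assume z: "z \<in> ?D"
    then show "norm (z\<^sup>2) < 1" by (simp add: norm_power abs_square_less_1)
    show "deriv g z = z\<^sup>2 * deriv h z"
      using DERIV_imp_deriv[OF dh[OF z]] DERIV_imp_deriv[OF dg[OF z]] by simp
  qed (use zero hg assms(6) CHD_P maps in \<open>auto intro!: holomorphic_intros\<close>)
  then show ?thesis
    using harmonic_shear_univalent poly maps by blast
qed

end
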